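(* Let $G$ be a finite group with center $Z(G)$, let $m$ be a positive integer, and suppose $G/Z(G) \cong D_{2m}$, where $D_{2m} = \langle a,b : a^m = b^2 = 1,\ bab^{-1} = a^{-1}\rangle$. Put $n = |Z(G)|$. Then $$\mathrm{Spec}(\Gamma_{nc}(G)) = \left\{ 0^{2nm-n-m-1},\ (-n)^{m-1},\ \left(\frac{n(m-1)\pm n\sqrt{(m-1)(5m-1)}}{2}\right)^1\right\}$$ and $$E(\Gamma_{nc}(G)) = n\left((m-1)+\sqrt{(m-1)(5m-1)}\right).$$
   Context: For a finite non-abelian group $G$ with center $Z(G)$, the non-commuting graph $\Gamma_{nc}(G)$ is the simple undirected graph with vertex set $G\setminus Z(G)$, in which two vertices $x,y$ are adjacent if and only if $xy \ne yx$. $\mathrm{Spec}(\mathcal{G}) = \{\lambda_1^{k_1},\dots,\lambda_r^{k_r}\}$ means that the eigenvalues of the adjacency matrix of the graph $\mathcal{G}$ are $\lambda_1,\dots,\lambda_r$ with multiplicities $k_1,\dots,k_r$ respectively; an entry with $\pm$ and exponent $1$ denotes two eigenvalues, each of multiplicity one. The energy $E(\mathcal{G})$ is the sum of the absolute values of the eigenvalues, counted with multiplicity. *)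

theory Defs
  imports
    "HOL-Algebra.Coset"
    "HOL-Library.Multiset"
    "Jordan_Normal_Form.Char_Poly"
    "Graph_Theory.Pair_Digraph"
begin

section \<open>Groups given by generators and relations\<close>

text \<open>
  A word is a list of letters; the letter \<open>(x, True)\<close> stands for the generator \<open>x\<close> and
  \<open>(x, False)\<close> for its formal inverse. A relation \<open>(l, r)\<close> stands for \<open>l = r\<close>.
  The group presented by all elements of the type \<open>'g\<close> subject to the relations \<open>R\<close> consists of
  the words modulo the least congruence that contains \<open>R\<close> and free cancellation.
\<close>

type_synonym 'g word = "('g \<times> bool) list"

inductive word_eq :: "('g word \<times> 'g word) set \<Rightarrow> 'g word \<Rightarrow> 'g word \<Rightarrow> bool"
  for R :: "('g word \<times> 'g word) set" where
  refl: "word_eq R u u"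
| sym: "word_eq R u v \<Longrightarrow> word_eq R v u"
| trans: "word_eq R u v \<Longrightarrow> word_eq R v w \<Longrightarrow> word_eq R u w"
| cong: "word_eq R u u' \<Longrightarrow> word_eq R v v' \<Longrightarrow> word_eq R (u @ v) (u' @ v')"
| cancel: "word_eq R [(x, e), (x, \<not> e)] []"
| relation: "(l, r) \<in> R \<Longrightarrow> word_eq R l r"

definition word_class :: "('g word \<times> 'g word) set \<Rightarrow> 'g word \<Rightarrow> 'g word set" where
  "word_class R u = {v. word_eq R u v}"

definition presented_group :: "('g word \<times> 'g word) set \<Rightarrow> 'g word set monoid" where
  "presented_group R =
    \<lparr>carrier = range (word_class R),
     monoid.mult = (\<lambda>U V. \<Union>u\<in>U. \<Union>v\<in>V. word_class R (u @ v)),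
     one = word_class R []\<rparr>"

lemma word_class_eq_iff: "word_class R u = word_class R v \<longleftrightarrow> word_eq R u v"
  unfolding word_class_def by (blast intro: word_eq.refl word_eq.sym word_eq.trans)

lemma presented_group_mult:
  "word_class R u \<otimes>\<^bsub>presented_group R\<^esub> word_class R v = word_class R (u @ v)"
proof -
  have "word_class R (u' @ v') = word_class R (u @ v)"
    if "u' \<in> word_class R u" "v' \<in> word_class R v" for u' v'
  proof -
    have "word_eq R u u'" "word_eq R v v'"
      using that by (auto simp: word_class_def)
    then show ?thesis
      by (simp add: word_class_eq_iff word_eq.cong word_eq.sym)
  qed
  then have "word_class R u \<otimes>\<^bsub>presented_group R\<^esub> word_class R v =
      (\<Union>u'\<in>word_class R u. \<Union>v'\<in>word_class R v. word_class R (u @ v))"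
    by (simp add: presented_group_def cong: SUP_cong_simp)
  moreover have "u \<in> word_class R u" "v \<in> word_class R v"
    by (simp_all add: word_class_def word_eq.refl)
  ultimately show ?thesis
    by blast
qed

lemma word_eq_left_inverse: "word_eq R (rev (map (\<lambda>(x, e). (x, \<not> e)) u) @ u) []"
proof (induction u)
  case Nil
  show ?case by (simp add: word_eq.refl)
next
  case (Cons a u)
  obtain x e where a: "a = (x, e)" by (cases a)
  let ?i = "rev (map (\<lambda>(x, e). (x, \<not> e)) u)"
  have "word_eq R [(x, \<not> e), (x, e)] []"
    using word_eq.cancel[of R x "\<not> e"] by simp
  then have "word_eq R (?i @ ([(x, \<not> e), (x, e)] @ u)) (?i @ ([] @ u))"
    by (intro word_eq.cong word_eq.refl)
  then show ?case
    using word_eq.trans[OF _ Cons.IH] by (simp add: a)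
qed

lemma group_presented_group: "group (presented_group R)"
proof (rule groupI)
  show "\<exists>y\<in>carrier (presented_group R). y \<otimes>\<^bsub>presented_group R\<^esub> x = \<one>\<^bsub>presented_group R\<^esub>"
    if "x \<in> carrier (presented_group R)" for x
  proof -
    obtain u where x: "x = word_class R u"
      using \<open>x \<in> carrier (presented_group R)\<close> by (auto simp: presented_group_def)
    let ?v = "rev (map (\<lambda>(x, e). (x, \<not> e)) u)"
    have "word_class R ?v \<otimes>\<^bsub>presented_group R\<^esub> x = word_class R []"
      unfolding x presented_group_mult word_class_eq_iff by (rule word_eq_left_inverse)
    moreover have "word_class R ?v \<in> carrier (presented_group R)"
      by (simp add: presented_group_def)
    moreover have "word_class R [] = \<one>\<^bsub>presented_group R\<^esub>"
      by (simp add: presented_group_def)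
    ultimately show ?thesis by metis
  qed
next
  have carr: "carrier (presented_group R) = range (word_class R)"
    and one: "\<one>\<^bsub>presented_group R\<^esub> = word_class R []"
    by (auto simp: presented_group_def)
  show "x \<otimes>\<^bsub>presented_group R\<^esub> y \<in> carrier (presented_group R)"
    if "x \<in> carrier (presented_group R)" "y \<in> carrier (presented_group R)" for x y
    using that unfolding carr by (auto simp: presented_group_mult)
  show "\<one>\<^bsub>presented_group R\<^esub> \<in> carrier (presented_group R)"
    by (simp add: carr one)
  show "x \<otimes>\<^bsub>presented_group R\<^esub> y \<otimes>\<^bsub>presented_group R\<^esub> z =
        x \<otimes>\<^bsub>presented_group R\<^esub> (y \<otimes>\<^bsub>presented_group R\<^esub> z)"
    if "x \<in> carrier (presented_group R)" "y \<in> carrier (presented_group R)"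
       "z \<in> carrier (presented_group R)" for x y z
    using that unfolding carr by (auto simp: presented_group_mult)
  show "\<one>\<^bsub>presented_group R\<^esub> \<otimes>\<^bsub>presented_group R\<^esub> x = x"
    if "x \<in> carrier (presented_group R)" for x
    using that unfolding carr one by (auto simp: presented_group_mult)
qed


section \<open>Dihedral groups\<close>

datatype dihedral_gen = gen_a | gen_b

text \<open>
  \<open>dihedral_group m\<close> is the group presented by
  \<open>a\<^sup>m = 1\<close>, \<open>b\<^sup>2 = 1\<close>, \<open>b a b\<^sup>-\<^sup>1 = a\<^sup>-\<^sup>1\<close>.
\<close>

definition dihedral_group :: "nat \<Rightarrow> dihedral_gen word set monoid" where
  "dihedral_group m = presented_group
    {(replicate m (gen_a, True), []),
     ([(gen_b, True), (gen_b, True)], []),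
     ([(gen_b, True), (gen_a, True), (gen_b, False)], [(gen_a, False)])}"


section \<open>Non-commuting graphs\<close>

definition group_center :: "('a, 'b) monoid_scheme \<Rightarrow> 'a set" where
  "group_center G = {z \<in> carrier G. \<forall>x\<in>carrier G. z \<otimes>\<^bsub>G\<^esub> x = x \<otimes>\<^bsub>G\<^esub> z}"

text \<open>An undirected edge is represented by the two arcs between its ends.\<close>

definition noncommuting_graph :: "('a, 'b) monoid_scheme \<Rightarrow> 'a pair_pre_digraph" where
  "noncommuting_graph G =
    \<lparr>pverts = carrier G - group_center G,
     parcs = {(x, y). x \<in> carrier G - group_center G \<and> y \<in> carrier G - group_center G \<and>
                      x \<otimes>\<^bsub>G\<^esub> y \<noteq> y \<otimes>\<^bsub>G\<^esub> x}\<rparr>"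

lemma pair_graph_noncommuting_graph:
  assumes "finite (carrier G)"
  shows "pair_graph (noncommuting_graph G)"
proof -
  have "parcs (noncommuting_graph G) \<subseteq> carrier G \<times> carrier G"
    by (auto simp: noncommuting_graph_def)
  then have "finite (parcs (noncommuting_graph G))"
    using assms by (meson finite_SigmaI finite_subset)
  then show ?thesis
    using assms
    by unfold_locales (auto simp: noncommuting_graph_def symmetric_def intro!: symI)
qed


section \<open>Spectrum and energy of a graph\<close>

text \<open>The adjacency matrix with respect to an enumeration \<open>vs\<close> of the vertices.\<close>

definition adjacency_matrix :: "'a pair_pre_digraph \<Rightarrow> 'a list \<Rightarrow> real mat" where
  "adjacency_matrix \<Gamma> vs =
    mat (length vs) (length vs) (\<lambda>(i, j). if (vs ! i, vs ! j) \<in> parcs \<Gamma> then 1 else 0)"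

text \<open>
  The multiset of eigenvalues, each counted with its multiplicity as a root of the
  characteristic polynomial. For an undirected graph the adjacency matrix is real symmetric,
  so all its complex eigenvalues are real. By \<open>char_poly_adjacency_matrix\<close> below, the
  choice of the enumeration does not matter.
\<close>

definition graph_spectrum :: "'a pair_pre_digraph \<Rightarrow> real multiset" where
  "graph_spectrum \<Gamma> =
    proots (char_poly (adjacency_matrix \<Gamma> (SOME vs. distinct vs \<and> set vs = pverts \<Gamma>)))"

definition graph_energy :: "'a pair_pre_digraph \<Rightarrow> real" where
  "graph_energy \<Gamma> = (\<Sum>x\<in>#graph_spectrum \<Gamma>. \<bar>x\<bar>)"

lemma char_poly_adjacency_matrix:
  assumes "distinct vs" "distinct ws" "set vs = set ws"
  shows "char_poly (adjacency_matrix \<Gamma> vs) = char_poly (adjacency_matrix \<Gamma> ws)"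
proof -
  let ?n = "length vs"
  let ?A = "adjacency_matrix \<Gamma> vs" and ?B = "adjacency_matrix \<Gamma> ws"
  have len: "length ws = ?n"
    using assms by (metis distinct_card)
  have "\<forall>i<?n. \<exists>k<?n. ws ! k = vs ! i"
    using assms(3) len by (metis in_set_conv_nth)
  then obtain p where p: "\<And>i. i < ?n \<Longrightarrow> p i < ?n" "\<And>i. i < ?n \<Longrightarrow> ws ! p i = vs ! i"
    by metis
  have inj: "p i = p j \<longleftrightarrow> i = j" if "i < ?n" "j < ?n" for i j
    using that p(2) assms(1) by (metis nth_eq_iff_index_eq)
  let ?P = "mat ?n ?n (\<lambda>(i, k). if k = p i then 1 else 0 :: real)"
  let ?Q = "mat ?n ?n (\<lambda>(k, j). if k = p j then 1 else 0 :: real)"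
  have AB: "?A \<in> carrier_mat ?n ?n" "?B \<in> carrier_mat ?n ?n"
    by (simp_all add: adjacency_matrix_def len)
  have PQ: "?P * ?Q = 1\<^sub>m ?n"
    by (rule eq_matI) (auto simp: scalar_prod_def inj p(1) if_distrib[of "\<lambda>x. x * _"]
        sum.delta cong: if_cong)
  then have QP: "?Q * ?P = 1\<^sub>m ?n"
    using mat_mult_left_right_inverse[of ?P ?n ?Q] by simp
  have PB: "?P * ?B = mat ?n ?n (\<lambda>(i, j). ?B $$ (p i, j))"
    using AB by (intro eq_matI) (auto simp: scalar_prod_def p(1) if_distrib[of "\<lambda>x. x * _"]
        sum.delta cong: if_cong)
  have "?A = ?P * ?B * ?Q"
    unfolding PB using AB
    by (intro eq_matI) (auto simp: scalar_prod_def p if_distrib[of "\<lambda>x. _ * x"]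
        sum.delta adjacency_matrix_def len cong: if_cong)
  then have "similar_mat ?A ?B"
    using AB PQ QP by (intro similar_matI[of _ _ ?P ?Q ?n]) auto
  then show ?thesis
    by (rule char_poly_similar)
qed

end

theory Submission
  imports Defs "HOL-Number_Theory.Cong"
begin

text \<open>
  The non-commuting graph is complete multipartite. Since \<open>D\<^sub>2\<^sub>m\<close> has elements \<open>a\<^sup>k b\<^sup>s\<close>,
  each element of \<open>G\<close> is a rotation (\<open>s = 0\<close>) or a reflection (\<open>s = 1\<close>). The rotations form an
  abelian subgroup, because they are generated by the center and one element. A rotation that
  commutes with a single reflection commutes with everything and is central. Consequently a
  reflection commutes with no noncentral rotation, and two reflections commute only if
  they differ by a central element (\<open>commute_iff\<close>). So two noncentral elements fail to commute if
  and only if they lie in different parts, where one part consists of the \<open>n (m - 1)\<close> noncentral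
  rotations and the other \<open>m\<close> parts are the cosets of reflections, each of size \<open>n\<close>.

  The characteristic polynomial of a complete multipartite graph follows from Sylvester's identity
  \<open>det (1 - A B) = det (1 - B A)\<close> (\<open>poly_char_poly_complete_multipartite\<close>). For part sizes \<open>d\<^sub>k\<close>,
  \<open>r\<close> parts and \<open>N\<close> vertices it is
  \<open>x\<^bsup>N-r\<^esup> \<Prod>(x + d\<^sub>k) (1 - \<Sum> d\<^sub>k / (x + d\<^sub>k))\<close>, here equal to
  \<open>x\<^bsup>2nm-n-m-1\<^esup> (x + n)\<^bsup>m-1\<^esup> (x\<^sup>2 - n (m - 1) x - n\<^sup>2 m (m - 1))\<close>.
  The quadratic factor has the two eigenvalues with the square root as its roots. They have opposite
  signs, which gives the energy.

  The dihedral group is given by generators and relations, so the distinctness of its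
  elements \<open>a\<^sup>k b\<^sup>s\<close> has to be derived from invariants of words
  (\<open>word_class_dihedral_eq_iff\<close>).
\<close>

section \<open>Characteristic polynomials of complete multipartite graphs\<close>

text \<open>
  Sylvester's identity. The block matrix with rows \<open>(1, A)\<close> and \<open>(B, 1)\<close>, multiplied on the right
  or on the left by the unipotent matrix that clears \<open>B\<close>, becomes block triangular with one of
  the two sides as its determinant.
\<close>

lemma det_one_minus_mult_commute:
  fixes A :: "'a :: idom mat"
  assumes A: "A \<in> carrier_mat n r" and B: "B \<in> carrier_mat r n"
  shows "det (1\<^sub>m n - A * B) = det (1\<^sub>m r - B * A)"
proof -
  let ?M = "four_block_mat (1\<^sub>m n) A B (1\<^sub>m r)"
  let ?L = "four_block_mat (1\<^sub>m n) (0\<^sub>m n r) (- B) (1\<^sub>m r)"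
  have AB: "A * B \<in> carrier_mat n n" and BA: "B * A \<in> carrier_mat r r"
    using A B by auto
  have M: "?M \<in> carrier_mat (n + r) (n + r)" and L: "?L \<in> carrier_mat (n + r) (n + r)"
    by simp_all
  have "?M * ?L = four_block_mat (1\<^sub>m n - A * B) A (0\<^sub>m r n) (1\<^sub>m r)"
    using A B AB
    by (subst mult_four_block_mat[where ?nr1.0 = n and ?nr2.0 = r and ?n1.0 = n and ?n2.0 = r
          and ?nc1.0 = n and ?nc2.0 = r])
      (auto simp: add_uminus_minus_mat)
  moreover have "?L * ?M = four_block_mat (1\<^sub>m n) A (0\<^sub>m r n) (1\<^sub>m r - B * A)"
    using A B BA
    by (subst mult_four_block_mat[where ?nr1.0 = n and ?nr2.0 = r and ?n1.0 = n and ?n2.0 = r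
          and ?nc1.0 = n and ?nc2.0 = r])
      (auto simp: comm_add_mat[of "- (B * A)" r r] add_uminus_minus_mat)
  moreover have "det (?M * ?L) = det (?L * ?M)"
    using det_mult[OF M L] det_mult[OF L M] by (simp only: mult.commute)
  ultimately show ?thesis
    using A AB BA
    by (simp add: det_four_block_mat_lower_left_zero[where n = n and m = r] minus_carrier_mat)
qed

text \<open>
  The matrix with all rows equal to \<open>c\<close> is a column of ones times the row \<open>c\<close>, so Sylvester's
  identity reduces the determinant to a \<open>1 \<times> 1\<close> one.
\<close>

lemma det_one_minus_equal_rows:
  fixes c :: "nat \<Rightarrow> 'a :: idom"
  shows "det (1\<^sub>m r - mat r r (\<lambda>(k, l). c l)) = 1 - (\<Sum>l<r. c l)"
proof -
  let ?u = "mat r 1 (\<lambda>_. 1 :: 'a)" and ?c = "mat 1 r (\<lambda>(_, l). c l)"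
  have "?u * ?c = mat r r (\<lambda>(k, l). c l)"
    by (rule eq_matI) (auto simp: scalar_prod_def)
  moreover have "1\<^sub>m 1 - ?c * ?u = mat 1 1 (\<lambda>_. 1 - (\<Sum>l<r. c l))"
    by (rule eq_matI) (auto simp: scalar_prod_def lessThan_atLeast0)
  ultimately show ?thesis
    using det_one_minus_mult_commute[of ?u r 1 ?c] by (simp add: det_single)
qed

text \<open>
  The adjacency matrix is \<open>P Q\<close>, where \<open>P\<close> records which vertex lies in which part and \<open>Q\<close> which
  vertex lies outside of which part. By Sylvester's identity only the matrix \<open>Q P\<close>, whose size is
  the number of parts, matters. Its \<open>l\<close>-th column has the size \<open>d\<^sub>l\<close> of the \<open>l\<close>-th part off the
  diagonal and 0 on it, so \<open>x - Q P\<close> is a diagonal matrix minus one with equal rows. Taking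
  \<open>x > 0\<close> lets the diagonal matrix be divided out; the values at positive numbers determine the
  polynomial.
\<close>

lemma poly_char_poly_complete_multipartite:
  fixes part :: "'a \<Rightarrow> nat" and x :: real
  defines "size_of \<equiv> \<lambda>vs k. real (card {v \<in> set vs. part v = k})"
  assumes "distinct vs"
    and part: "\<And>v. v \<in> set vs \<Longrightarrow> part v < r"
    and arcs: "\<And>u v. u \<in> set vs \<Longrightarrow> v \<in> set vs \<Longrightarrow> (u, v) \<in> parcs \<Gamma> \<longleftrightarrow> part u \<noteq> part v"
    and "x > 0"
  shows "poly (char_poly (adjacency_matrix \<Gamma> vs)) x =
    x ^ length vs * (\<Prod>k<r. 1 + size_of vs k / x) * (1 - (\<Sum>k<r. size_of vs k / (x + size_of vs k)))"
proof -
  let ?N = "length vs" and ?d = "size_of vs"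
  let ?A = "adjacency_matrix \<Gamma> vs"
  let ?P = "mat ?N r (\<lambda>(i, k). if part (vs ! i) = k then 1 else 0 :: real)"
  let ?Q = "mat r ?N (\<lambda>(k, j). if part (vs ! j) = k then 0 else 1 / x)"
  have A: "?A \<in> carrier_mat ?N ?N"
    by (simp add: adjacency_matrix_def)
  have d_nonneg: "?d k \<ge> 0" for k
    by (simp add: size_of_def)
  \<comment> \<open>With the factor \<open>1 / x\<close> put into \<open>Q\<close>, Sylvester's identity applies to \<open>1 - P Q\<close>.\<close>
  have "- char_matrix ?A x = x \<cdot>\<^sub>m (1\<^sub>m ?N - ?P * ?Q)"
    using \<open>x > 0\<close>
    by (intro eq_matI)
      (auto simp: char_matrix_def adjacency_matrix_def arcs scalar_prod_def part
        if_distrib[of "\<lambda>y. y * _"] sum.delta cong: if_cong)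
  then have "poly (char_poly ?A) x = x ^ ?N * det (1\<^sub>m ?N - ?P * ?Q)"
    using char_poly_matrix[OF A, of x] by (simp add: det_smult)
  also have "det (1\<^sub>m ?N - ?P * ?Q) = det (1\<^sub>m r - ?Q * ?P)"
    by (rule det_one_minus_mult_commute) auto
  also have "1\<^sub>m r - ?Q * ?P =
      (1\<^sub>m r - mat r r (\<lambda>(k, l). ?d l / (x + ?d l))) * mat_diag r (\<lambda>l. 1 + ?d l / x)"
  proof (rule eq_matI)
    fix k l assume "k < dim_row ((1\<^sub>m r - mat r r (\<lambda>(k, l). ?d l / (x + ?d l))) * mat_diag r (\<lambda>l. 1 + ?d l / x))"
      and "l < dim_col ((1\<^sub>m r - mat r r (\<lambda>(k, l). ?d l / (x + ?d l))) * mat_diag r (\<lambda>l. 1 + ?d l / x))"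
    then have kl: "k < r" "l < r"
      by (auto simp: mat_diag_def)
    have card: "?d l = real (card {j. j < ?N \<and> part (vs ! j) = l})"
    proof -
      have "{v \<in> set vs. part v = l} = (\<lambda>j. vs ! j) ` {j. j < ?N \<and> part (vs ! j) = l}"
        by (auto simp: in_set_conv_nth)
      moreover have "inj_on (\<lambda>j. vs ! j) {j. j < ?N \<and> part (vs ! j) = l}"
        using \<open>distinct vs\<close> by (auto simp: inj_on_def nth_eq_iff_index_eq)
      ultimately show ?thesis
        by (simp add: size_of_def card_image)
    qed
    have "(?Q * ?P) $$ (k, l) =
        (\<Sum>j = 0..<?N. if part (vs ! j) = l then if k = l then 0 else 1 / x else 0)"
      using kl by (cases "k = l") (auto simp: scalar_prod_def intro!: sum.neutral sum.cong)
    also have "\<dots> = (if k = l then 0 else ?d l / x)"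
      by (simp add: card sum.If_cases Int_def)
    finally have QP: "(?Q * ?P) $$ (k, l) = (if k = l then 0 else ?d l / x)" .
    have "?d l / (x + ?d l) * (1 + ?d l / x) = ?d l / x"
    proof -
      have "x + ?d l \<noteq> 0"
        using \<open>x > 0\<close> d_nonneg[of l] by linarith
      then show ?thesis
        using \<open>x > 0\<close> by (simp add: divide_simps)
    qed
    then show "(1\<^sub>m r - ?Q * ?P) $$ (k, l) =
      ((1\<^sub>m r - mat r r (\<lambda>(k, l). ?d l / (x + ?d l))) * mat_diag r (\<lambda>l. 1 + ?d l / x)) $$ (k, l)"
      using kl QP by (subst mat_diag_mult_right[of _ r r]) (auto simp: left_diff_distrib)
  qed (auto simp: mat_diag_def)
  also have "det \<dots> = det (1\<^sub>m r - mat r r (\<lambda>(k, l). ?d l / (x + ?d l))) *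
      det (mat_diag r (\<lambda>l. 1 + ?d l / x))"
    by (rule det_mult) (auto simp: minus_carrier_mat)
  also have "det (mat_diag r (\<lambda>l. 1 + ?d l / x)) = (\<Prod>k<r. 1 + ?d k / x)"
    by (subst det_upper_triangular[of _ r])
      (auto simp: upper_triangular_def prod_list_diag_prod mat_diag_def lessThan_atLeast0)
  finally show ?thesis
    by (simp only: det_one_minus_equal_rows mult_ac)
qed

section \<open>The word problem for the presented dihedral group\<close>

abbreviation dihedral_relations :: "nat \<Rightarrow> (dihedral_gen word \<times> dihedral_gen word) set" where
  "dihedral_relations m \<equiv>
    {(replicate m (gen_a, True), []),
     ([(gen_b, True), (gen_b, True)], []),
     ([(gen_b, True), (gen_a, True), (gen_b, False)], [(gen_a, False)])}"

text \<open>
  Reading \<open>a\<close> as a rotation by one step and \<open>b\<close> as a reflection, \<open>word_flip\<close> and \<open>word_rot\<close>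
  are the coordinates \<open>s\<close> and \<open>k\<close> of a word in the form \<open>a\<^sup>k b\<^sup>s\<close>. The exponent is kept as
  an integer, that is, computed in the infinite dihedral group; only the relation \<open>a\<^sup>m = 1\<close>
  forces its reduction modulo \<open>m\<close>.
\<close>

fun word_flip :: "dihedral_gen word \<Rightarrow> bool" where
  "word_flip [] = False"
| "word_flip ((gen_a, e) # w) = word_flip w"
| "word_flip ((gen_b, e) # w) = (\<not> word_flip w)"

fun word_rot :: "dihedral_gen word \<Rightarrow> int" where
  "word_rot [] = 0"
| "word_rot ((gen_a, e) # w) = (if e then 1 else -1) + word_rot w"
| "word_rot ((gen_b, e) # w) = - word_rot w"

lemma word_flip_append: "word_flip (u @ v) = (word_flip u \<noteq> word_flip v)"
  by (induction u rule: word_flip.induct) auto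

lemma word_rot_append:
  "word_rot (u @ v) = word_rot u + (if word_flip u then - word_rot v else word_rot v)"
  by (induction u rule: word_flip.induct) auto

lemma word_flip_replicate_a: "word_flip (replicate i (gen_a, e)) = False"
  by (induction i) auto

lemma word_rot_replicate_a: "word_rot (replicate i (gen_a, True)) = int i"
  by (induction i) auto

text \<open>
  The relations do not collapse the group further than intended: the coordinates multiply as in
  the semidirect product, and each defining relation respects them.
\<close>

lemma word_eq_invariants:
  assumes "word_eq (dihedral_relations m) u v"
  shows "word_flip u = word_flip v \<and> [word_rot u = word_rot v] (mod int m)"
  using assms
proof induction
  case (cong u u' v v')
  then show ?case
    by (auto simp: word_flip_append word_rot_append cong_minus_minus_iff
        intro!: cong_add cong_diff)
next
  case (cancel x e)
  show ?case by (cases x; cases e) auto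
next
  case (relation l r)
  then show ?case
    by (auto simp: word_flip_replicate_a word_rot_replicate_a cong_0_iff)
qed (auto intro: cong_sym cong_trans)

text \<open>
  A letter appended on the right of \<open>a\<^sup>k b\<^sup>s\<close> has to pass at most one \<open>b\<close>, so the rules
  \<open>b a = a\<^sup>-\<^sup>1 b\<close> and \<open>b a\<^sup>-\<^sup>1 = a b\<close> restore the form. This is why the induction takes
  words apart at their end.
\<close>

lemma word_class_normal_form:
  defines "a m \<equiv> word_class (dihedral_relations m) [(gen_a, True)]"
    and "b m \<equiv> word_class (dihedral_relations m) [(gen_b, True)]"
  shows "word_class (dihedral_relations m) u =
    a m [^]\<^bsub>dihedral_group m\<^esub> word_rot u \<otimes>\<^bsub>dihedral_group m\<^esub>
      (if word_flip u then b m else \<one>\<^bsub>dihedral_group m\<^esub>)"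
proof -
  let ?R = "dihedral_relations m" and ?D = "dihedral_group m"
  let ?a = "a m" and ?b = "b m"
  interpret D: group ?D
    unfolding dihedral_group_def by (rule group_presented_group)
  have carr: "word_class ?R w \<in> carrier ?D" for w
    by (simp add: dihedral_group_def presented_group_def)
  have mult: "word_class ?R (v @ w) = word_class ?R v \<otimes>\<^bsub>?D\<^esub> word_class ?R w" for v w
    by (simp add: dihedral_group_def presented_group_mult)
  have one: "word_class ?R [] = \<one>\<^bsub>?D\<^esub>"
    by (simp add: dihedral_group_def presented_group_def)
  have inv: "word_class ?R [(g, False)] = inv\<^bsub>?D\<^esub> word_class ?R [(g, True)]" for g
  proof (rule D.inv_equality[symmetric])
    show "word_class ?R [(g, False)] \<otimes>\<^bsub>?D\<^esub> word_class ?R [(g, True)] = \<one>\<^bsub>?D\<^esub>"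
      using word_eq.cancel[of ?R g False]
      by (simp flip: mult one add: word_class_eq_iff)
  qed (rule carr)+
  have [simp]: "?a \<in> carrier ?D" "?b \<in> carrier ?D"
    unfolding a_def b_def by (rule carr)+
  have bb: "?b \<otimes>\<^bsub>?D\<^esub> ?b = \<one>\<^bsub>?D\<^esub>"
    unfolding b_def by (simp flip: mult one add: word_class_eq_iff word_eq.relation)
  then have inv_b: "inv\<^bsub>?D\<^esub> ?b = ?b"
    by (simp add: D.inv_equality)
  have "?b \<otimes>\<^bsub>?D\<^esub> ?a \<otimes>\<^bsub>?D\<^esub> inv\<^bsub>?D\<^esub> ?b = inv\<^bsub>?D\<^esub> ?a"
    unfolding a_def b_def by (simp flip: mult inv add: word_class_eq_iff word_eq.relation)
  then have ba: "?b \<otimes>\<^bsub>?D\<^esub> ?a = inv\<^bsub>?D\<^esub> ?a \<otimes>\<^bsub>?D\<^esub> ?b"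
    by (metis D.inv_solve_right D.inv_closed D.m_closed \<open>?a \<in> carrier ?D\<close> \<open>?b \<in> carrier ?D\<close>)
  have ba': "?b \<otimes>\<^bsub>?D\<^esub> inv\<^bsub>?D\<^esub> ?a = ?a \<otimes>\<^bsub>?D\<^esub> ?b"
  proof -
    have "?a \<otimes>\<^bsub>?D\<^esub> ?b = ?a \<otimes>\<^bsub>?D\<^esub> (?b \<otimes>\<^bsub>?D\<^esub> ?a) \<otimes>\<^bsub>?D\<^esub> inv\<^bsub>?D\<^esub> ?a"
      by (simp add: D.m_assoc)
    also have "\<dots> = ?b \<otimes>\<^bsub>?D\<^esub> inv\<^bsub>?D\<^esub> ?a"
      unfolding ba by (simp flip: D.m_assoc)
    finally show ?thesis ..
  qed
  show ?thesis
  proof (induction u rule: rev_induct)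
    case Nil
    show ?case by (simp add: one)
  next
    case (snoc l w)
    obtain g e where l: "l = (g, e)" by (cases l)
    show ?case
    proof (cases g)
      case gen_a
      have letter: "word_class ?R [l] = (if e then ?a else inv\<^bsub>?D\<^esub> ?a)"
        using gen_a l by (simp add: a_def inv)
      have pow: "?a [^]\<^bsub>?D\<^esub> (word_rot w + 1) = ?a [^]\<^bsub>?D\<^esub> word_rot w \<otimes>\<^bsub>?D\<^esub> ?a"
        "?a [^]\<^bsub>?D\<^esub> (word_rot w - 1) = ?a [^]\<^bsub>?D\<^esub> word_rot w \<otimes>\<^bsub>?D\<^esub> inv\<^bsub>?D\<^esub> ?a"
        by (simp_all add: D.int_pow_mult D.int_pow_diff)
      have "word_rot [l] = (if e then 1 else -1)" "\<not> word_flip [l]"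
        using gen_a l by simp_all
      then show ?thesis
        by (simp add: mult letter snoc.IH word_rot_append word_flip_append pow D.m_assoc ba ba')
    next
      case gen_b
      have letter: "word_class ?R [l] = ?b"
        using gen_b l inv_b by (cases e) (simp_all add: b_def inv)
      have "word_rot [l] = 0" "word_flip [l]"
        using gen_b l by simp_all
      then show ?thesis
        by (simp add: mult letter snoc.IH word_rot_append word_flip_append D.m_assoc bb)
    qed
  qed
qed

text \<open>
  This solves the word problem and shows that the presented group has, for \<open>m > 0\<close>, exactly
  the \<open>2m\<close> elements \<open>a\<^sup>k b\<^sup>s\<close> with \<open>0 \<le> k < m\<close>.
\<close>

theorem word_class_dihedral_eq_iff:
  "word_class (dihedral_relations m) u = word_class (dihedral_relations m) v \<longleftrightarrow>
    word_flip u = word_flip v \<and> [word_rot u = word_rot v] (mod int m)"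
proof
  assume "word_class (dihedral_relations m) u = word_class (dihedral_relations m) v"
  then show "word_flip u = word_flip v \<and> [word_rot u = word_rot v] (mod int m)"
    by (simp add: word_class_eq_iff word_eq_invariants)
next
  let ?R = "dihedral_relations m" and ?D = "dihedral_group m"
  let ?a = "word_class ?R [(gen_a, True)]"
  interpret D: group ?D
    unfolding dihedral_group_def by (rule group_presented_group)
  have a: "?a \<in> carrier ?D"
    by (simp add: dihedral_group_def presented_group_def)
  have one: "word_class ?R [] = \<one>\<^bsub>?D\<^esub>"
    by (simp add: dihedral_group_def presented_group_def)
  have "word_eq ?R (replicate m (gen_a, True)) []"
    by (rule word_eq.relation) simp
  then have am: "?a [^]\<^bsub>?D\<^esub> int m = \<one>\<^bsub>?D\<^esub>"
    using word_class_normal_form[of m "replicate m (gen_a, True)"] a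
    by (simp add: word_flip_replicate_a word_rot_replicate_a one flip: word_class_eq_iff)
  assume uv: "word_flip u = word_flip v \<and> [word_rot u = word_rot v] (mod int m)"
  then obtain q where "word_rot v = word_rot u + int m * q"
    by (auto simp: cong_iff_lin)
  moreover have "?a [^]\<^bsub>?D\<^esub> (int m * q) = \<one>\<^bsub>?D\<^esub>"
    using D.int_pow_pow[OF a, of "int m" q] am by simp
  ultimately have "?a [^]\<^bsub>?D\<^esub> word_rot v = ?a [^]\<^bsub>?D\<^esub> word_rot u"
    using D.int_pow_mult[OF a, of "word_rot u" "int m * q"] a by simp
  then show "word_class ?R u = word_class ?R v"
    using uv by (simp add: word_class_normal_form[of m u] word_class_normal_form[of m v])
qed

section \<open>The center of a group\<close>

lemma (in group) commute_center_translate: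
  assumes "x \<in> carrier G" "y \<in> carrier G" "z \<in> group_center G" "x \<otimes> y = y \<otimes> x"
  shows "(z \<otimes> x) \<otimes> y = y \<otimes> (z \<otimes> x)"
proof -
  have z: "z \<in> carrier G" "z \<otimes> y = y \<otimes> z"
    using assms by (auto simp: group_center_def)
  have "(z \<otimes> x) \<otimes> y = (z \<otimes> y) \<otimes> x"
    using assms z(1) by (simp add: m_assoc)
  then show ?thesis
    using assms z by (simp add: m_assoc)
qed

lemma (in group) subgroup_group_center: "subgroup (group_center G) G"
proof
  fix x assume "x \<in> group_center G"
  then have x: "x \<in> carrier G" and comm: "\<And>y. y \<in> carrier G \<Longrightarrow> x \<otimes> y = y \<otimes> x"
    by (auto simp: group_center_def)
  have "inv x \<otimes> y = y \<otimes> inv x" if y: "y \<in> carrier G" for y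
  proof -
    have "x \<otimes> inv y = inv y \<otimes> x"
      using comm[of "inv y"] y by simp
    then have "inv (x \<otimes> inv y) = inv (inv y \<otimes> x)"
      by simp
    then show ?thesis
      using x y by (simp add: inv_mult_group)
  qed
  then show "inv x \<in> group_center G"
    using x by (simp add: group_center_def)
next
  fix x y assume "x \<in> group_center G" "y \<in> group_center G"
  then have xy: "x \<in> group_center G" "x \<in> carrier G" "y \<in> carrier G"
    and y: "\<And>w. w \<in> carrier G \<Longrightarrow> y \<otimes> w = w \<otimes> y"
    unfolding group_center_def by blast+
  have "x \<otimes> y \<otimes> w = w \<otimes> (x \<otimes> y)" if "w \<in> carrier G" for w
    using that xy y by (intro commute_center_translate)
  then show "x \<otimes> y \<in> group_center G"
    unfolding group_center_def using xy by blast
qed (auto simp: group_center_def)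

lemma (in group) normal_group_center: "group_center G \<lhd> G"
  unfolding normal_inv_iff
proof (intro conjI ballI)
  fix x h assume x: "x \<in> carrier G" and h: "h \<in> group_center G"
  then have "x \<otimes> h \<otimes> inv x = h"
    by (auto simp: group_center_def) (metis m_assoc inv_closed r_inv r_one)
  then show "x \<otimes> h \<otimes> inv x \<in> group_center G"
    using h by simp
qed (rule subgroup_group_center)

lemma (in group) r_coset_center_eq_iff:
  assumes "x \<in> carrier G" "y \<in> carrier G"
  shows "group_center G #> x = group_center G #> y \<longleftrightarrow> (\<exists>z\<in>group_center G. x = z \<otimes> y)"
proof -
  have "group_center G #> x = group_center G #> y \<longleftrightarrow> x \<in> group_center G #> y"
    using assms subgroup_group_center by (metis rcos_self repr_independence)
  then show ?thesis
    by (auto simp: r_coset_def)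
qed

section \<open>Groups whose central quotient is dihedral\<close>

text \<open>
  The isomorphism of the central quotient with the dihedral group, pulled back to \<open>G\<close>: each
  element carries the coordinates \<open>a\<^sup>k b\<^sup>s\<close> of its coset, with \<open>rot\<close> as \<open>k\<close> and \<open>flip\<close>
  as \<open>s\<close>. Elements with \<open>flip\<close> are called reflections, the others rotations.
\<close>

locale dihedral_quotient = group G for G (structure) +
  fixes m :: nat and flip :: "'a \<Rightarrow> bool" and rot :: "'a \<Rightarrow> int"
  assumes finite_carrier: "finite (carrier G)"
    and m_pos: "m > 0"
    and flip_mult: "\<lbrakk>x \<in> carrier G; y \<in> carrier G\<rbrakk> \<Longrightarrow> flip (x \<otimes> y) = (flip x \<noteq> flip y)"
    and rot_mult: "\<lbrakk>x \<in> carrier G; y \<in> carrier G\<rbrakk> \<Longrightarrow>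
      rot (x \<otimes> y) = (rot x + (if flip x then - rot y else rot y)) mod int m"
    and rot_range: "x \<in> carrier G \<Longrightarrow> rot x \<in> {0..<int m}"
    and coset_iff: "\<lbrakk>x \<in> carrier G; y \<in> carrier G\<rbrakk> \<Longrightarrow>
      group_center G #> x = group_center G #> y \<longleftrightarrow> flip x = flip y \<and> rot x = rot y"
    and surj: "i \<in> {0..<int m} \<Longrightarrow> \<exists>x\<in>carrier G. flip x = t \<and> rot x = i"

lemma dihedral_quotient_exists:
  fixes G (structure)
  assumes "group G" "finite (carrier G)" "m > 0" and iso: "G Mod group_center G \<cong> dihedral_group m"
  obtains flip rot where "dihedral_quotient G m flip rot"
proof -
  interpret group G by fact
  interpret Z: normal "group_center G" G by (rule normal_group_center)
  let ?Q = "G Mod group_center G" and ?D = "dihedral_group m" and ?R = "dihedral_relations m"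
  obtain \<phi> where \<phi>: "\<phi> \<in> iso ?Q ?D"
    using iso by (auto simp: is_iso_def)
  have carrier_Q: "group_center G #> x \<in> carrier ?Q" if "x \<in> carrier G" for x
    using that by (simp add: carrier_FactGroup)
  have carrier_D: "carrier ?D = range (word_class ?R)"
    by (simp add: dihedral_group_def presented_group_def)
  define w where "w x = (SOME u. word_class ?R u = \<phi> (group_center G #> x))" for x
  have w: "word_class ?R (w x) = \<phi> (group_center G #> x)" if "x \<in> carrier G" for x
  proof -
    have "\<phi> (group_center G #> x) \<in> carrier ?D"
      using \<phi> carrier_Q[OF that] by (auto simp: iso_def dest: hom_in_carrier)
    then have "\<exists>u. word_class ?R u = \<phi> (group_center G #> x)"
      unfolding carrier_D by (elim rangeE) (rule exI, simp)
    then show ?thesis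
      unfolding w_def by (rule someI_ex)
  qed
  define flip where "flip x = word_flip (w x)" for x
  define rot where "rot x = word_rot (w x) mod int m" for x
  have "dihedral_quotient G m flip rot"
  proof
    fix x y assume x: "x \<in> carrier G" and y: "y \<in> carrier G"
    have "word_class ?R (w (x \<otimes> y)) = \<phi> ((group_center G #> x) <#> (group_center G #> y))"
      using x y by (simp add: w Z.rcos_sum)
    also have "\<dots> = \<phi> (group_center G #> x) \<otimes>\<^bsub>?D\<^esub> \<phi> (group_center G #> y)"
      using \<phi> hom_mult[of \<phi> ?Q ?D "group_center G #> x" "group_center G #> y"] carrier_Q x y
      by (simp add: iso_def)
    also have "\<dots> = word_class ?R (w x @ w y)"
      using x y by (simp add: w[symmetric] dihedral_group_def presented_group_mult)
    finally have "word_flip (w (x \<otimes> y)) = word_flip (w x @ w y) \<and>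
        [word_rot (w (x \<otimes> y)) = word_rot (w x @ w y)] (mod int m)"
      by (simp only: word_class_dihedral_eq_iff)
    then show "flip (x \<otimes> y) = (flip x \<noteq> flip y)"
      and "rot (x \<otimes> y) = (rot x + (if flip x then - rot y else rot y)) mod int m"
      by (auto simp: flip_def rot_def word_flip_append word_rot_append cong_def mod_simps)
    have "inj_on \<phi> (carrier ?Q)"
      using \<phi> by (simp add: iso_def bij_betw_def)
    then have "group_center G #> x = group_center G #> y \<longleftrightarrow> word_class ?R (w x) = word_class ?R (w y)"
      using x y carrier_Q by (simp add: w inj_on_eq_iff)
    then show "group_center G #> x = group_center G #> y \<longleftrightarrow> flip x = flip y \<and> rot x = rot y"
      by (simp add: word_class_dihedral_eq_iff flip_def rot_def cong_def)
  next
    fix i t assume i: "i \<in> {0..<int m}"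
    let ?u = "replicate (nat i) (gen_a, True) @ (if t then [(gen_b, True)] else [])"
    have "word_class ?R ?u \<in> \<phi> ` carrier ?Q"
      using \<phi> carrier_D by (auto simp: iso_def bij_betw_def)
    then obtain x where "x \<in> carrier G" "word_class ?R ?u = \<phi> (group_center G #> x)"
      by (auto simp: carrier_FactGroup)
    then have "x \<in> carrier G" "word_class ?R (w x) = word_class ?R ?u"
      by (simp_all add: w)
    moreover have "word_flip ?u = t" "word_rot ?u = i"
      using i by (auto simp: word_flip_append word_rot_append word_flip_replicate_a word_rot_replicate_a)
    ultimately show "\<exists>x\<in>carrier G. flip x = t \<and> rot x = i"
      using i by (auto simp: word_class_dihedral_eq_iff flip_def rot_def cong_def)
  qed (use assms in \<open>auto simp: rot_def\<close>)
  then show ?thesis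
    by (rule that)
qed

context dihedral_quotient
begin

lemma center_iff:
  assumes "x \<in> carrier G"
  shows "x \<in> group_center G \<longleftrightarrow> \<not> flip x \<and> rot x = 0"
proof -
  have one: "\<not> flip \<one>" "rot \<one> = 0"
  proof -
    show "\<not> flip \<one>"
      using flip_mult[of \<one> \<one>] by auto
    then have "[rot \<one> + rot \<one> = rot \<one> + 0] (mod int m)"
      using rot_mult[of \<one> \<one>] by (simp add: cong_def) (metis mod_mod_trivial)
    then have "[rot \<one> = 0] (mod int m)"
      by (simp only: cong_add_lcancel)
    then show "rot \<one> = 0"
      using rot_range[of \<one>] by (auto simp: cong_def)
  qed
  have "x \<in> group_center G \<longleftrightarrow> group_center G #> x = group_center G #> \<one>"
    using assms subgroup_group_center
    by (metis coset_join1 coset_join2 coset_mult_one subgroup.subset)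
  then show ?thesis
    using coset_iff[of x \<one>] assms one by auto
qed

lemma commute_if_same_coset:
  assumes "x \<in> carrier G" "y \<in> carrier G" "flip x = flip y" "rot x = rot y"
  shows "x \<otimes> y = y \<otimes> x"
proof -
  obtain z where "z \<in> group_center G" "x = z \<otimes> y"
    using assms coset_iff[of x y] r_coset_center_eq_iff[of x y] by auto
  then show ?thesis
    using assms commute_center_translate[of y y z] by simp
qed

text \<open>
  The rotations are generated by the center and one further element \<open>g\<close>, a preimage of \<open>a\<close>.
\<close>

lemma rotations_commute:
  assumes "x \<in> carrier G" "y \<in> carrier G" "\<not> flip x" "\<not> flip y"
  shows "x \<otimes> y = y \<otimes> x"
proof -
  \<comment> \<open>Reduced modulo \<open>m\<close> because 1 is out of range for \<open>m = 1\<close>.\<close>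
  obtain g where g: "g \<in> carrier G" "\<not> flip g" "rot g = 1 mod int m"
    using surj[of "1 mod int m" False] m_pos by auto
  have pow: "\<not> flip (g [^] i) \<and> rot (g [^] i) = int i mod int m" for i :: nat
  proof (induction i)
    case 0
    have "\<one> \<in> group_center G"
      by (simp add: group_center_def)
    then show ?case
      by (simp add: center_iff)
  next
    case (Suc i)
    then show ?case
      using g by (simp add: flip_mult rot_mult mod_simps add.commute)
  qed
  have power: "\<exists>z\<in>group_center G. \<exists>i::nat. u = z \<otimes> g [^] i"
    if "u \<in> carrier G" "\<not> flip u" for u
  proof -
    have "group_center G #> u = group_center G #> (g [^] nat (rot u))"
      using that rot_range[of u] pow[of "nat (rot u)"] coset_iff[of u "g [^] nat (rot u)"] g(1)
      by simp
    then show ?thesis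
      using that g(1) r_coset_center_eq_iff[of u "g [^] nat (rot u)"] by auto
  qed
  obtain z z' and i j :: nat where z: "z \<in> group_center G" "x = z \<otimes> g [^] i"
    and z': "z' \<in> group_center G" "y = z' \<otimes> g [^] j"
    using power assms by metis
  have "g [^] j \<otimes> g [^] i = g [^] i \<otimes> g [^] j"
    using g(1) by (simp add: nat_pow_mult add.commute)
  then have "y \<otimes> g [^] i = g [^] i \<otimes> y"
    unfolding z'(2) using g(1) z'(1) by (intro commute_center_translate) auto
  then show ?thesis
    unfolding z(2) using g(1) z(1) assms(2) by (intro commute_center_translate) auto
qed

text \<open>
  A rotation commutes with all rotations, and a single reflection together with the rotations
  generates \<open>G\<close>. This is why an even \<open>m\<close> is not exceptional: \<open>a\<^bsup>m/2\<^esup>\<close> is central in the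
  quotient, but no preimage of it commutes with a reflection in \<open>G\<close>.
\<close>

lemma rotation_central_if_commutes_reflection:
  assumes x: "x \<in> carrier G" "flip x" and y: "y \<in> carrier G" "\<not> flip y"
    and comm: "x \<otimes> y = y \<otimes> x"
  shows "y \<in> group_center G"
proof -
  have "y \<otimes> g = g \<otimes> y" if g: "g \<in> carrier G" for g
  proof (cases "flip g")
    case False
    then show ?thesis
      using g y rotations_commute by simp
  next
    case True
    have "\<not> flip (g \<otimes> x)"
      using True g x by (simp add: flip_mult)
    then have "g \<otimes> x \<otimes> y = y \<otimes> (g \<otimes> x)"
      using g x y by (intro rotations_commute) auto
    then have "g \<otimes> y \<otimes> x = y \<otimes> g \<otimes> x"
      using g x y comm by (simp add: m_assoc)
    then show ?thesis
      using g x y by simp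
  qed
  then show ?thesis
    using y by (simp add: group_center_def)
qed

text \<open>
  For two commuting reflections \<open>x\<close> and \<open>y\<close>, the rotation \<open>x y\<close> commutes with \<open>x\<close>, hence is
  central; as its exponent is \<open>rot x - rot y\<close> modulo \<open>m\<close>, the reflections lie in the same coset.
\<close>

lemma commute_iff:
  assumes x: "x \<in> carrier G - group_center G" and y: "y \<in> carrier G - group_center G"
  shows "x \<otimes> y = y \<otimes> x \<longleftrightarrow> flip x = flip y \<and> (flip x \<longrightarrow> rot x = rot y)"
proof
  assume comm: "x \<otimes> y = y \<otimes> x"
  have same: "flip x = flip y"
    using x y comm rotation_central_if_commutes_reflection by (metis DiffE)
  moreover have "rot x = rot y" if "flip x"
  proof -
    have "x \<otimes> (x \<otimes> y) = (x \<otimes> y) \<otimes> x"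
      using x y by (simp add: m_assoc flip: comm)
    then have "x \<otimes> y \<in> group_center G"
      using x y same that by (intro rotation_central_if_commutes_reflection[of x]) (auto simp: flip_mult)
    then have "[rot x - rot y = 0] (mod int m)"
      using x y that center_iff[of "x \<otimes> y"] by (auto simp: rot_mult cong_def)
    then have "[rot x = rot y] (mod int m)"
      using cong_diff_iff_cong_0 by blast
    then show ?thesis
      using x y rot_range[of x] rot_range[of y] by (auto simp: cong_def)
  qed
  ultimately show "flip x = flip y \<and> (flip x \<longrightarrow> rot x = rot y)"
    by simp
next
  assume "flip x = flip y \<and> (flip x \<longrightarrow> rot x = rot y)"
  then show "x \<otimes> y = y \<otimes> x"
    using x y commute_if_same_coset[of x y] rotations_commute[of x y] by blast
qed

text \<open>
  For \<open>m = 1\<close> the quotient by the center would be cyclic of order 2, which makes \<open>G\<close> abelian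
  and the quotient trivial.
\<close>

lemma m_ge_2: "m \<ge> 2"
proof (rule ccontr)
  assume "\<not> m \<ge> 2"
  then have "m = 1"
    using m_pos by simp
  obtain x where x: "x \<in> carrier G" "flip x"
    using surj[of 0 True] m_pos by auto
  have rot0: "rot y = 0" if "y \<in> carrier G" for y
    using rot_range[OF that] \<open>m = 1\<close> by simp
  have "x \<otimes> y = y \<otimes> x" if y: "y \<in> carrier G" for y
  proof (cases "flip y")
    case True
    then show ?thesis
      using x y rot0 by (simp add: commute_if_same_coset)
  next
    case False
    then have "y \<in> group_center G"
      using y rot0 by (simp add: center_iff)
    then show ?thesis
      using x by (simp add: group_center_def)
  qed
  then have "x \<in> group_center G"
    using x by (simp add: group_center_def)
  then show False
    using x by (simp add: center_iff)
qed

lemma card_coset: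
  assumes "i \<in> {0..<int m}"
  shows "card {x \<in> carrier G. flip x = t \<and> rot x = i} = card (group_center G)"
proof -
  obtain g where g: "g \<in> carrier G" "flip g = t" "rot g = i"
    using surj[OF assms] by blast
  have sub: "group_center G \<subseteq> carrier G"
    by (auto simp: group_center_def)
  have "{x \<in> carrier G. flip x = t \<and> rot x = i} = {x \<in> carrier G. group_center G #> x = group_center G #> g}"
    using g coset_iff by auto
  also have "\<dots> = group_center G #> g"
  proof (intro equalityI subsetI)
    fix x assume "x \<in> group_center G #> g"
    then show "x \<in> {x \<in> carrier G. group_center G #> x = group_center G #> g}"
      using repr_independence[of x _ g] g(1) subgroup_group_center r_coset_subset_G[OF sub g(1)]
      by auto
  qed (use rcos_self subgroup_group_center in auto)
  finally show ?thesis
    using g(1) sub card_rcosets_equal[of "group_center G #> g" "group_center G"]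
    by (auto simp: rcosetsI)
qed

text \<open>
  The vertices fall into the noncentral rotations (number 0) and, for each reflection of the
  quotient, its coset (numbers 1 to \<open>m\<close>).
\<close>

definition part :: "'a \<Rightarrow> nat" where
  "part x = (if flip x then Suc (nat (rot x)) else 0)"

lemma part_less: "x \<in> carrier G \<Longrightarrow> part x < Suc m"
  using rot_range[of x] by (auto simp: part_def)

lemma noncommuting_graph_multipartite:
  assumes "x \<in> pverts (noncommuting_graph G)" "y \<in> pverts (noncommuting_graph G)"
  shows "(x, y) \<in> parcs (noncommuting_graph G) \<longleftrightarrow> part x \<noteq> part y"
proof -
  have xy: "x \<in> carrier G - group_center G" "y \<in> carrier G - group_center G"
    using assms by (simp_all add: noncommuting_graph_def)
  have "part x = part y \<longleftrightarrow> flip x = flip y \<and> (flip x \<longrightarrow> rot x = rot y)"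
    using xy rot_range[of x] rot_range[of y] by (simp add: part_def eq_nat_nat_iff)
  then show ?thesis
    using xy commute_iff[OF xy] by (simp add: noncommuting_graph_def)
qed

lemma card_rotation_part:
  "card {x \<in> pverts (noncommuting_graph G). part x = 0} = card (group_center G) * (m - 1)"
proof -
  have "{x \<in> pverts (noncommuting_graph G). part x = 0} =
      (\<Union>i\<in>{1..<int m}. {x \<in> carrier G. flip x = False \<and> rot x = i})"
    using rot_range by (force simp: noncommuting_graph_def part_def center_iff)
  also have "card \<dots> = (\<Sum>i\<in>{1..<int m}. card {x \<in> carrier G. flip x = False \<and> rot x = i})"
    using finite_carrier by (intro card_UN_disjoint) auto
  also have "\<dots> = (\<Sum>i\<in>{1..<int m}. card (group_center G))"
    using card_coset[of _ False] by (intro sum.cong) auto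
  finally show ?thesis
    using m_pos by (simp add: nat_diff_distrib)
qed

lemma card_reflection_part:
  assumes "k < m"
  shows "card {x \<in> pverts (noncommuting_graph G). part x = Suc k} = card (group_center G)"
proof -
  have "{x \<in> pverts (noncommuting_graph G). part x = Suc k} =
      {x \<in> carrier G. flip x = True \<and> rot x = int k}"
    using rot_range by (force simp: noncommuting_graph_def part_def center_iff)
  then show ?thesis
    using assms card_coset[of "int k" True] by simp
qed

lemma card_pverts_noncommuting_graph:
  "card (pverts (noncommuting_graph G)) = card (group_center G) * (m - 1) + card (group_center G) * m"
proof -
  let ?V = "pverts (noncommuting_graph G)"
  have V: "finite ?V" "?V \<subseteq> carrier G"
    using finite_carrier by (auto simp: noncommuting_graph_def)
  have "?V = (\<Union>k<Suc m. {x \<in> ?V. part x = k})"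
    using V(2) part_less by blast
  then have "card ?V = card (\<Union>k<Suc m. {x \<in> ?V. part x = k})"
    by (rule arg_cong)
  also have "\<dots> = (\<Sum>k<Suc m. card {x \<in> ?V. part x = k})"
    using V(1) by (intro card_UN_disjoint) auto
  also have "\<dots> = card (group_center G) * (m - 1) + (\<Sum>k<m. card (group_center G))"
    by (simp only: sum.lessThan_Suc_shift card_rotation_part) (simp add: card_reflection_part)
  finally show ?thesis
    by simp
qed

end

section \<open>Spectrum and energy\<close>

lemma poly_eqI_pos:
  fixes p q :: "real poly"
  assumes "\<And>x. x > 0 \<Longrightarrow> poly p x = poly q x"
  shows "p = q"
proof (rule ccontr)
  assume "p \<noteq> q"
  then have "finite {x. poly (p - q) x = 0}"
    by (intro poly_roots_finite) simp
  moreover have "{0<..} \<subseteq> {x. poly (p - q) x = 0}"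
    using assms by auto
  ultimately show False
    using infinite_Ioi finite_subset by blast
qed

text \<open>
  The value of the characteristic polynomial of a complete multipartite graph with one part of
  size \<open>n \<mu>\<close> and \<open>\<mu> + 1\<close> parts of size \<open>n\<close>. With \<open>m = \<mu> + 1\<close> the exponent of \<open>x\<close> is the
  number \<open>2nm - n\<close> of vertices when \<open>K = 2nm - n - m - 1\<close>.
\<close>

lemma multipartite_factorization:
  fixes x n :: real
  assumes "x > 0" "n \<ge> 0"
  shows "x ^ (K + \<mu> + 2) * ((1 + n * \<mu> / x) * (1 + n / x) ^ Suc \<mu>) *
      (1 - (n * \<mu> / (x + n * \<mu>) + Suc \<mu> * (n / (x + n)))) =
    x ^ K * (x + n) ^ \<mu> * (x\<^sup>2 - n * \<mu> * x - n\<^sup>2 * \<mu> * Suc \<mu>)"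
proof -
  let ?c = "n * \<mu>"
  have pos: "x + ?c > 0" "x + n > 0"
    using assms by (auto intro: add_pos_nonneg)
  have power: "x ^ (K + \<mu> + 2) * ((1 + ?c / x) * (1 + n / x) ^ Suc \<mu>) =
      x ^ K * (x + n) ^ \<mu> * ((x + ?c) * (x + n))"
  proof -
    have "1 + ?c / x = (x + ?c) / x" "1 + n / x = (x + n) / x"
      using assms by (simp_all add: field_simps)
    then show ?thesis
      using assms by (simp add: power_divide power_add power2_eq_square)
  qed
  have "(x + ?c) * (x + n) * (1 - (?c / (x + ?c) + Suc \<mu> * (n / (x + n)))) =
      (x + ?c) * (x + n) - ((x + ?c) * (?c / (x + ?c))) * (x + n)
        - Suc \<mu> * (x + ?c) * ((x + n) * (n / (x + n)))"
    by (simp only: algebra_simps)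
  also have "\<dots> = (x + ?c) * (x + n) - ?c * (x + n) - Suc \<mu> * (x + ?c) * n"
    using pos by simp
  also have "\<dots> = x\<^sup>2 - ?c * x - n\<^sup>2 * \<mu> * Suc \<mu>"
    by (simp add: algebra_simps power2_eq_square)
  finally show ?thesis
    unfolding power by (simp only: mult.assoc)
qed

lemma repeat_mset_single: "repeat_mset k {#x#} = replicate_mset k x"
  by (induction k) auto

lemma proots_factors:
  fixes a b c d :: "'a :: idom"
  shows "proots ([:- a, 1:] ^ k * [:- b, 1:] ^ l * ([:- c, 1:] * [:- d, 1:])) =
    replicate_mset k a + replicate_mset l b + {#c, d#}"
  by (simp add: proots_mult proots_power repeat_mset_single del: mult_pCons_left mult_pCons_right)

theorem theorem2p5:
  fixes G :: "('a, 'b) monoid_scheme" and m n :: nat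
  assumes "group G" and "finite (carrier G)"
    and "m > 0"
    and "G Mod group_center G \<cong> dihedral_group m"
    and "n = card (group_center G)"
  shows "graph_spectrum (noncommuting_graph G) =
           replicate_mset (2 * n * m - n - m - 1) 0
         + replicate_mset (m - 1) (- real n)
         + {# (real n * (real m - 1) + real n * sqrt ((real m - 1) * (5 * real m - 1))) / 2,
              (real n * (real m - 1) - real n * sqrt ((real m - 1) * (5 * real m - 1))) / 2 #}
       \<and> graph_energy (noncommuting_graph G) =
           real n * ((real m - 1) + sqrt ((real m - 1) * (5 * real m - 1)))"
proof -
  let ?\<Gamma> = "noncommuting_graph G"
  obtain flip rot where "dihedral_quotient G m flip rot"
    using dihedral_quotient_exists assms by blast
  then interpret dihedral_quotient G m flip rot .
  define vs where "vs = (SOME vs. distinct vs \<and> set vs = pverts ?\<Gamma>)"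
  have "finite (pverts ?\<Gamma>)"
    using assms(2) by (simp add: noncommuting_graph_def)
  then have vs: "distinct vs" "set vs = pverts ?\<Gamma>"
    using someI_ex[OF finite_distinct_list, of "pverts ?\<Gamma>"] unfolding vs_def by (auto simp: conj_commute)
  define \<mu> where "\<mu> = m - 1"
  define K where "K = 2 * n * m - n - m - 1"
  define s where "s = sqrt ((real m - 1) * (5 * real m - 1))"
  \<comment> \<open>The two roots of the quadratic factor of the characteristic polynomial.\<close>
  define l1 where "l1 = (real n * (real m - 1) + real n * s) / 2"
  define l2 where "l2 = (real n * (real m - 1) - real n * s) / 2"
  have m: "m = Suc \<mu>" "\<mu> \<ge> 1"
    using m_ge_2 by (auto simp: \<mu>_def)
  have s2: "s\<^sup>2 = (real m - 1) * (5 * real m - 1)"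
    unfolding s_def using m by (intro real_sqrt_pow2) auto
  have "n \<ge> 1"
  proof -
    have "\<one>\<^bsub>G\<^esub> \<in> group_center G"
      by (simp add: group_center_def)
    moreover have "finite (group_center G)"
      using assms(2) by (simp add: group_center_def)
    ultimately show ?thesis
      unfolding assms(5) by (metis One_nat_def Suc_leI card_gt_0_iff empty_iff)
  qed
  \<comment> \<open>As \<open>n \<ge> 1\<close> and \<open>m \<ge> 2\<close>, the subtractions of natural numbers in \<open>K\<close> are not truncated.\<close>
  have N: "length vs = K + \<mu> + 2"
  proof -
    have "length vs = n * \<mu> + n * m"
      using vs card_pverts_noncommuting_graph by (simp add: \<mu>_def assms(5) flip: distinct_card)
    moreover have "n * \<mu> \<ge> \<mu>"
      using \<open>n \<ge> 1\<close> by simp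
    moreover have "n * m = n * \<mu> + n" "2 * n * m = n * m + n * m"
      by (simp_all add: m(1))
    ultimately show ?thesis
      using \<open>n \<ge> 1\<close> m unfolding K_def by linarith
  qed
  have "char_poly (adjacency_matrix ?\<Gamma> vs) =
      [:- 0, 1:] ^ K * [:- (- real n), 1:] ^ \<mu> * ([:- l1, 1:] * [:- l2, 1:])"
  proof (rule poly_eqI_pos)
    fix x :: real assume "x > 0"
    let ?size = "\<lambda>k. real (card {v \<in> set vs. part v = k})"
    have size: "?size 0 = real n * real \<mu>" "\<And>k. k < m \<Longrightarrow> ?size (Suc k) = real n"
      using card_rotation_part card_reflection_part by (simp_all add: vs(2) assms(5) \<mu>_def)
    have "poly (char_poly (adjacency_matrix ?\<Gamma> vs)) x =
        x ^ length vs * (\<Prod>k<Suc m. 1 + ?size k / x) * (1 - (\<Sum>k<Suc m. ?size k / (x + ?size k)))"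
      using vs \<open>x > 0\<close> noncommuting_graph_multipartite part_less
      by (intro poly_char_poly_complete_multipartite) (auto simp: noncommuting_graph_def)
    also have "(\<Prod>k<Suc m. 1 + ?size k / x) = (1 + real n * real \<mu> / x) * (1 + real n / x) ^ Suc \<mu>"
      unfolding prod.lessThan_Suc_shift size(1) using size(2) by (simp flip: m(1))
    also have "(\<Sum>k<Suc m. ?size k / (x + ?size k)) =
        real n * real \<mu> / (x + real n * real \<mu>) + real (Suc \<mu>) * (real n / (x + real n))"
      unfolding sum.lessThan_Suc_shift size(1) using size(2) by (simp flip: m(1))
    also note N
    also note multipartite_factorization[OF \<open>x > 0\<close> of_nat_0_le_iff, of K \<mu> n]
    also have "x\<^sup>2 - real n * real \<mu> * x - (real n)\<^sup>2 * real \<mu> * real (Suc \<mu>) = (x - l1) * (x - l2)"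
    proof -
      have "(x - l1) * (x - l2) =
          x\<^sup>2 - real n * (real m - 1) * x + (real n)\<^sup>2 * ((real m - 1)\<^sup>2 - s\<^sup>2) / 4"
        by (simp add: l1_def l2_def field_simps power2_eq_square)
      also have "\<dots> = x\<^sup>2 - real n * real \<mu> * x - (real n)\<^sup>2 * real \<mu> * real (Suc \<mu>)"
        unfolding s2 m(1) by (simp add: field_simps power2_eq_square)
      finally show ?thesis ..
    qed
    finally show "poly (char_poly (adjacency_matrix ?\<Gamma> vs)) x =
        poly ([:- 0, 1:] ^ K * [:- (- real n), 1:] ^ \<mu> * ([:- l1, 1:] * [:- l2, 1:])) x"
      by (simp add: algebra_simps del: mult_pCons_left mult_pCons_right)
  qed
  then have spectrum: "graph_spectrum ?\<Gamma> =
      replicate_mset K 0 + replicate_mset \<mu> (- real n) + {#l1, l2#}"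
    unfolding graph_spectrum_def vs_def[symmetric] by (simp only: proots_factors)
  have "graph_energy ?\<Gamma> = real n * ((real m - 1) + s)"
  proof -
    have "(real m - 1)\<^sup>2 \<le> s\<^sup>2"
      unfolding s2 unfolding power2_eq_square using m by (intro mult_left_mono) auto
    moreover have "s \<ge> 0"
      unfolding s_def using m by simp
    ultimately have "real m - 1 \<le> s"
      by (rule power2_le_imp_le)
    then have "real n * (real m - 1) \<le> real n * s"
      by (rule mult_left_mono) simp
    moreover have "0 \<le> real n * (real m - 1)"
      using m by simp
    \<comment> \<open>The roots have opposite signs, so their absolute values add up to their difference.\<close>
    ultimately have "\<bar>l1\<bar> + \<bar>l2\<bar> = real n * s"
      unfolding l1_def l2_def by (simp add: abs_if field_simps)
    then show ?thesis
      unfolding graph_energy_def spectrum using m by (simp add: algebra_simps)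
  qed
  then show ?thesis
    using spectrum unfolding K_def \<mu>_def l1_def l2_def s_def by blast
qed

end
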